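(* For any strictly increasing sequence of positive integers $(y_k)_{k\ge 1}$ such that $$k\left(\frac{3+\sqrt5}{2}\right)^k=o(y_k)\quad\text{as }k\to\infty,$$ there exists a trap sequence $(x_k)_{k\ge1}$ (a sequence of integers with $0<x_1<x_2<\cdots$) such that the model with traps $(x_k)_{k\ge 1}$ is critical and $x_k\le y_k$ for all $k\ge 1$.
   Context: The model is the trapped random walk on the half-line: with $D_+=\{x_k\}_{k\ge1}$, it is the Markov chain on $\{0,1,2,\dots\}\cup\{s\}$ where $s$ (the sink) and $0$ are absorbing, from $x\ge 1$ with $x\notin D_+$ the walk moves to $x-1$ or $x+1$ with probability $1/2$ each, and from $x\in D_+$ it moves to $x-1$, $x+1$ or $s$ with probability $1/3$ each. Let $T$ be the first time the walk is in $\{0,s\}$, and let $\mathbb{E}_x(T)\in[0,\infty]$ be its expectation for the walk started at $x$. The model is called critical if $\mathbb{E}_1(T)=\infty$ and non-critical if $\mathbb{E}_1(T)<\infty$ (the finiteness of $\mathbb{E}_x(T)$ does not depend on the starting point $x\ge 1$). *)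

theory Defs
  imports "HOL-Probability.Probability"
begin

text \<open>
  The law, on the space of trajectories, of the Markov chain with transition kernel K started
  at x.  It is the Ionescu-Tulcea measure: coordinate 0 is x, and given the coordinates
  before time \<open>n > 0\<close>, coordinate n has the distribution \<open>K (\<omega> (n - 1))\<close>.
\<close>

definition chain_step :: "('a \<Rightarrow> 'a pmf) \<Rightarrow> 'a \<Rightarrow> nat \<Rightarrow> (nat \<Rightarrow> 'a) \<Rightarrow> 'a measure" where
  "chain_step K x n \<omega> = measure_pmf (if n = 0 then return_pmf x else K (\<omega> (n - 1)))"

definition chain_law :: "('a \<Rightarrow> 'a pmf) \<Rightarrow> 'a \<Rightarrow> (nat \<Rightarrow> 'a) measure" where
  "chain_law K x =
     projective_family.lim UNIV
       (Ionescu_Tulcea.CI (chain_step K x) (\<lambda>_. count_space UNIV)) (\<lambda>_. count_space UNIV)"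

lemma Ionescu_Tulcea_chain_step: "Ionescu_Tulcea (chain_step K x) (\<lambda>_. count_space UNIV)"
proof (rule Ionescu_Tulcea.intro)
  fix i
  show "chain_step K x i \<in> PiM {0..<i} (\<lambda>_. count_space UNIV) \<rightarrow>\<^sub>M subprob_algebra (count_space UNIV)"
  proof (cases i)
    case 0
    then show ?thesis
      by (simp add: chain_step_def[abs_def] space_subprob_algebra prob_space_imp_subprob_space prob_space_measure_pmf)
  next
    case (Suc j)
    have *: "(\<lambda>s. measure_pmf (K s)) \<in> count_space UNIV \<rightarrow>\<^sub>M subprob_algebra (count_space UNIV)"
      by (auto simp: space_subprob_algebra prob_space_imp_subprob_space prob_space_measure_pmf)
    have "(\<lambda>\<omega>. \<omega> j) \<in> PiM {0..<i} (\<lambda>_. count_space UNIV) \<rightarrow>\<^sub>M count_space UNIV"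
      by (rule measurable_component_singleton) (simp add: Suc)
    from measurable_compose[OF this *] show ?thesis
      by (simp add: chain_step_def[abs_def] Suc)
  qed
qed (simp add: chain_step_def prob_space_measure_pmf)

lemma prob_space_chain_law: "prob_space (chain_law K x)"
proof -
  interpret Ionescu_Tulcea "chain_step K x" "\<lambda>_. count_space UNIV"
    by (rule Ionescu_Tulcea_chain_step)
  show ?thesis
    unfolding chain_law_def
    by (rule prob_space_distrD[of "\<lambda>\<omega>. restrict \<omega> {}" _ "PiM {} (\<lambda>_. count_space UNIV)"])
       (simp_all add: distr_lim PF.prob_space_P measurable_cong_sets[OF PF.sets_lim refl])
qed

lemma sets_chain_law [measurable_cong]: "sets (chain_law K x) = sets (PiM UNIV (\<lambda>_. count_space UNIV))"
proof -
  interpret Ionescu_Tulcea "chain_step K x" "\<lambda>_. count_space UNIV"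
    by (rule Ionescu_Tulcea_chain_step)
  show ?thesis
    unfolding chain_law_def by (rule PF.sets_lim)
qed

lemma emeasure_chain_law_path:
  fixes K :: "'a :: countable \<Rightarrow> 'a pmf"
  shows "emeasure (chain_law K x) {\<omega>. \<forall>i\<le>n. \<omega> i = s i} =
           of_bool (s 0 = x) * (\<Prod>i<n. ennreal (pmf (K (s i)) (s (Suc i))))"
proof -
  let ?M = "\<lambda>_::nat. count_space (UNIV :: 'a set)"
  interpret Ionescu_Tulcea "chain_step K x" ?M
    by (rule Ionescu_Tulcea_chain_step)
  let ?A = "\<lambda>n. {restrict s {0..<n}}"
  have A_eq: "?A n = PiE {0..<n} (\<lambda>i. {s i})" for n
    by (subst PiE_singleton[of "restrict s {0..<n}" "{0..<n}", symmetric]) (auto intro!: PiE_cong)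
  have A [measurable]: "?A n \<in> sets (PiM {0..<n} ?M)" for n
    unfolding A_eq by (rule sets_PiM_I_finite) auto
  have sp: "\<omega> \<in> space (PiM {0..<n} ?M) \<longleftrightarrow> \<omega> \<in> extensional {0..<n}" for \<omega> and n
    by (auto simp: space_PiM PiE_def)
  have step: "emeasure (eP n \<omega>) (?A (Suc n)) =
      indicator (?A n) \<omega> * emeasure (chain_step K x n (restrict s {0..<n})) {s n}"
    if w: "\<omega> \<in> space (PiM {0..<n} ?M)" for n \<omega>
  proof -
    have "fun_upd \<omega> n -` ?A (Suc n) = (if \<omega> = restrict s {0..<n} then {s n} else {})"
      using w unfolding sp
      by (auto simp: fun_eq_iff extensional_def restrict_def less_Suc_eq split: if_splits) (metis less_irrefl)
    then show ?thesis
      by (subst emeasure_eP[OF w A]) (auto simp: indicator_def)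
  qed
  have C_eq: "emeasure (C 0 n (\<lambda>_. undefined)) (?A n) =
      (\<Prod>i<n. emeasure (chain_step K x i (restrict s {0..<i})) {s i})" for n
  proof (induction n)
    case 0
    show ?case
      using A[of 0] by (subst C.simps, subst emeasure_return) (simp_all add: restrict_def)
  next
    case (Suc n)
    let ?u = "\<lambda>_::nat. undefined :: 'a"
    have u: "?u \<in> space (PiM {0..<0} ?M)"
      by (simp add: sp extensional_def)
    have sC: "sets (C 0 n ?u) = sets (PiM {0..<n} ?M)" "space (C 0 n ?u) = space (PiM {0..<n} ?M)"
      using sets_C[OF u, of n] space_C[OF u, of n] by simp_all
    have "emeasure (C 0 (Suc n) ?u) (?A (Suc n)) = (\<integral>\<^sup>+\<omega>. emeasure (eP n \<omega>) (?A (Suc n)) \<partial>C 0 n ?u)"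
    proof -
      have ne: "space (C 0 n ?u) \<noteq> {}"
        using prob_space.not_empty[OF prob_space_C[OF u]] .
      have m: "eP n \<in> C 0 n ?u \<rightarrow>\<^sub>M subprob_algebra (PiM {0..<Suc n} ?M)"
        using measurable_eP[of n] measurable_cong_sets[OF sC(1) refl] by blast
      show ?thesis
        using emeasure_bind[OF ne m A] by simp
    qed
    also have "\<dots> = (\<integral>\<^sup>+\<omega>. emeasure (chain_step K x n (restrict s {0..<n})) {s n} * indicator (?A n) \<omega> \<partial>C 0 n ?u)"
      by (intro nn_integral_cong) (simp add: sC step mult.commute)
    also have "\<dots> = emeasure (chain_step K x n (restrict s {0..<n})) {s n} * emeasure (C 0 n ?u) (?A n)"
      by (rule nn_integral_cmult_indicator) (simp only: sC A)
    finally show ?case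
      by (simp only: Suc.IH prod.lessThan_Suc mult.commute)
  qed
  have "{\<omega>. \<forall>i\<le>n. \<omega> i = s i} = PF.emb UNIV {0..<Suc n} (?A (Suc n))"
    by (auto simp: prod_emb_def space_PiM fun_eq_iff restrict_def less_Suc_eq_le split: if_splits)
  then have "emeasure (chain_law K x) {\<omega>. \<forall>i\<le>n. \<omega> i = s i} = emeasure (CI {0..<Suc n}) (?A (Suc n))"
    unfolding chain_law_def using lim[of "{0..<Suc n}" "?A (Suc n)"] A by simp
  also have "\<dots> = emeasure (C 0 (Suc n) (\<lambda>_. undefined)) (?A (Suc n))"
    by (subst emeasure_CI[OF subset_refl A]) (subst prod_emb_id, auto simp: space_PiM)
  also have "\<dots> = (\<Prod>i<Suc n. emeasure (chain_step K x i (restrict s {0..<i})) {s i})"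
    by (rule C_eq)
  also have "\<dots> = of_bool (s 0 = x) * (\<Prod>i<n. ennreal (pmf (K (s i)) (s (Suc i))))"
    by (subst prod.lessThan_Suc_shift)
       (auto simp: chain_step_def emeasure_pmf_single intro!: arg_cong2[of _ _ _ _ "(*)"] prod.cong)
  finally show ?thesis .
qed

datatype state = Site nat | Sink

instance state :: countable
  by countable_datatype

fun trap_kernel :: "nat set \<Rightarrow> state \<Rightarrow> state pmf" where
  "trap_kernel D Sink = return_pmf Sink"
| "trap_kernel D (Site x) =
     (if x = 0 then return_pmf (Site 0)
      else if x \<in> D then pmf_of_set {Site (x - 1), Site (x + 1), Sink}
      else pmf_of_set {Site (x - 1), Site (x + 1)})"

text \<open>The infimum of the empty set is \<open>\<infinity>\<close>, the value for trajectories that are never absorbed.\<close>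

definition absorption_time :: "(nat \<Rightarrow> state) \<Rightarrow> enat" where
  "absorption_time \<omega> = (INF n \<in> {n. \<omega> n \<in> {Site 0, Sink}}. enat n)"

lemma measurable_absorption_time [measurable]:
  "absorption_time \<in> PiM UNIV (\<lambda>_. count_space UNIV) \<rightarrow>\<^sub>M count_space UNIV"
proof -
  define P where "P = (\<lambda>s. s \<in> {Site 0, Sink})"
  have "absorption_time \<omega> = (if \<exists>n. P (\<omega> n) then enat (LEAST n. P (\<omega> n)) else \<infinity>)" for \<omega>
  proof (cases "\<exists>n. P (\<omega> n)")
    case True
    have "absorption_time \<omega> = (INF n \<in> {n. P (\<omega> n)}. enat n)"
      by (simp add: absorption_time_def P_def)
    also have "\<dots> = enat (LEAST n. P (\<omega> n))"
    proof (rule antisym)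
      show "(INF n \<in> {n. P (\<omega> n)}. enat n) \<le> enat (LEAST n. P (\<omega> n))"
        using LeastI_ex[OF True] by (intro INF_lower) simp
      show "enat (LEAST n. P (\<omega> n)) \<le> (INF n \<in> {n. P (\<omega> n)}. enat n)"
        by (intro INF_greatest) (simp add: Least_le)
    qed
    finally show ?thesis
      using True by simp
  next
    case False
    then have "{n. \<omega> n \<in> {Site 0, Sink}} = {}"
      by (simp add: P_def)
    with False show ?thesis
      unfolding absorption_time_def by (simp add: top_enat_def)
  qed
  then have "absorption_time = (\<lambda>\<omega>. if \<exists>n. P (\<omega> n) then enat (LEAST n. P (\<omega> n)) else \<infinity>)"
    by blast
  moreover have "(\<lambda>\<omega>. if \<exists>n. P (\<omega> n) then enat (LEAST n. P (\<omega> n)) else \<infinity>)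
      \<in> PiM UNIV (\<lambda>_. count_space UNIV) \<rightarrow>\<^sub>M count_space UNIV"
    by measurable
  ultimately show ?thesis
    by simp
qed

definition expected_absorption_time :: "nat set \<Rightarrow> nat \<Rightarrow> ennreal" where
  "expected_absorption_time D x =
     (\<integral>\<^sup>+\<omega>. ennreal_of_enat (absorption_time \<omega>) \<partial>chain_law (trap_kernel D) (Site x))"

definition critical :: "nat set \<Rightarrow> bool" where
  "critical D \<longleftrightarrow> expected_absorption_time D 1 = \<infinity>"

text \<open>Sequences are indexed from 1; the value at index 0 is irrelevant.\<close>

definition trap_sequence :: "(nat \<Rightarrow> nat) \<Rightarrow> bool" where
  "trap_sequence x \<longleftrightarrow> 0 < x 1 \<and> strict_mono_on {1..} x"

definition trap_set :: "(nat \<Rightarrow> nat) \<Rightarrow> nat set" where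
  "trap_set x = x ` {1..}"

end

theory Submission
  imports Defs
begin

text \<open>
  Let h be harmonic for the trapped walk with h(0) = 0 and h(1) = 1: it is linear between traps
  and its slope increases by h(x) at a trap x.  If no trap lies strictly between p and q, the walk
  from 1 reaches p + 1 before absorption with probability 1 / h(p + 1), and from there it stays
  between p and q for a mean time q - p - 1; so a gap that is large compared with h(p + 1)
  makes the expectation large.  Along consecutive traps h only grows
  like the power of \<open>(3 + sqrt 5) / 2\<close>, an eigenvalue of the matrix with rows (1, 1), (1, 2) acting on
  (value, slope).  Any earlier large gaps multiply h by a constant only, so it is enough to place
  traps consecutively until y allows a gap exceeding k h(p + 1), jump to the bound y, and repeat.
\<close>

section \<open>Marginals of the chain\<close>

lemma space_chain_law [simp]: "space (chain_law K x) = UNIV"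
  using sets_eq_imp_space_eq[OF sets_chain_law[of K x]] by (simp add: space_PiM)

lemma measurable_chain_law_coordinate [measurable]:
  "(\<lambda>\<omega>. \<omega> n) \<in> chain_law K x \<rightarrow>\<^sub>M count_space UNIV"
  unfolding measurable_cong_sets[OF sets_chain_law refl]
  by (rule measurable_component_singleton) simp

lemma sets_chain_law_Collect [measurable]:
  fixes K :: "'a :: countable \<Rightarrow> 'a pmf"
  shows "{\<omega>. P (\<omega> n)} \<in> sets (chain_law K x)"
  using measurable_sets[OF measurable_chain_law_coordinate[of n K x], of "Collect P"]
  by (simp add: vimage_def)

text \<open>One step of the Markov property, recovered from the cylinder probabilities. A countable
  state space has only countably many histories up to time n that end in y, and extending any one of
  them by z multiplies its probability by the same factor.\<close>

lemma emeasure_chain_law_transition: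
  fixes K :: "'a :: countable \<Rightarrow> 'a pmf"
  shows "emeasure (chain_law K x) {\<omega>. \<omega> n = y \<and> \<omega> (Suc n) = z} =
    emeasure (chain_law K x) {\<omega>. \<omega> n = y} * ennreal (pmf (K y) z)"
proof -
  let ?M = "chain_law K x"
  define I where "I = {s :: 'a list. length s = Suc n \<and> s ! n = y}"
  have prefix: "{\<omega>. \<forall>i\<le>n. \<omega> i = s ! i} \<in> sets ?M" for s
  proof -
    have "{\<omega>. \<forall>i\<le>n. \<omega> i = s ! i} = (\<Inter>i\<in>{..n}. {\<omega>. \<omega> i = s ! i})"
      by auto
    then show ?thesis
      using sets_chain_law_Collect[of "\<lambda>a. a = s ! i" i K x for i]
      by (auto intro!: sets.finite_INT)
  qed
  \<comment> \<open>Q stays arbitrary because the decomposition is used twice: with the event that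
    the next state is z, and with the whole space to sum the history probabilities back up.\<close>
  have split: "emeasure ?M {\<omega>. \<omega> n = y \<and> \<omega> \<in> Q} =
      (\<integral>\<^sup>+s. emeasure ?M ({\<omega>. \<forall>i\<le>n. \<omega> i = s ! i} \<inter> Q) \<partial>count_space I)"
    if Q: "Q \<in> sets ?M" for Q
  proof -
    have "{\<omega>. \<omega> n = y \<and> \<omega> \<in> Q} = (\<Union>s\<in>I. {\<omega>. \<forall>i\<le>n. \<omega> i = s ! i} \<inter> Q)" (is "?L = ?R")
    proof
      show "?L \<subseteq> ?R"
      proof
        fix \<omega> assume w: "\<omega> \<in> ?L"
        have "map \<omega> [0..<Suc n] \<in> I"
          using w unfolding I_def by (simp del: upt_Suc)
        moreover have "\<forall>i\<le>n. \<omega> i = map \<omega> [0..<Suc n] ! i"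
          by (simp del: upt_Suc)
        ultimately show "\<omega> \<in> ?R"
          using w by blast
      qed
      show "?R \<subseteq> ?L"
        by (auto simp: I_def)
    qed
    moreover have "disjoint_family_on (\<lambda>s. {\<omega>. \<forall>i\<le>n. \<omega> i = s ! i} \<inter> Q) I"
      by (auto simp: disjoint_family_on_def I_def list_eq_iff_nth_eq less_Suc_eq_le)
    ultimately show ?thesis
      using prefix Q by (simp add: emeasure_UN_countable del: UN_simps)
  qed
  have step: "emeasure ?M ({\<omega>. \<forall>i\<le>n. \<omega> i = s ! i} \<inter> {\<omega>. \<omega> (Suc n) = z}) =
      emeasure ?M {\<omega>. \<forall>i\<le>n. \<omega> i = s ! i} * ennreal (pmf (K y) z)" if s: "s \<in> I" for s
  proof -
    have "{\<omega>. \<forall>i\<le>n. \<omega> i = s ! i} \<inter> {\<omega>. \<omega> (Suc n) = z} =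
        {\<omega>. \<forall>i\<le>Suc n. \<omega> i = (s @ [z]) ! i}"
      using s by (auto simp: I_def nth_append le_Suc_eq)
    moreover have "(\<Prod>i<n. ennreal (pmf (K ((s @ [z]) ! i)) ((s @ [z]) ! Suc i))) =
        (\<Prod>i<n. ennreal (pmf (K (s ! i)) (s ! Suc i)))"
      using s by (intro prod.cong) (auto simp: I_def nth_append)
    ultimately show ?thesis
      using s by (simp add: emeasure_chain_law_path I_def nth_append mult.assoc)
  qed
  have "emeasure ?M {\<omega>. \<omega> n = y \<and> \<omega> (Suc n) = z} =
      (\<integral>\<^sup>+s. emeasure ?M ({\<omega>. \<forall>i\<le>n. \<omega> i = s ! i} \<inter> {\<omega>. \<omega> (Suc n) = z}) \<partial>count_space I)"
    using split[of "{\<omega>. \<omega> (Suc n) = z}"] sets_chain_law_Collect[of "\<lambda>a. a = z" "Suc n" K x]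
    by simp
  also have "\<dots> = (\<integral>\<^sup>+s. emeasure ?M {\<omega>. \<forall>i\<le>n. \<omega> i = s ! i} * ennreal (pmf (K y) z) \<partial>count_space I)"
    by (intro nn_integral_cong) (simp add: step)
  also have "\<dots> = emeasure ?M {\<omega>. \<omega> n = y} * ennreal (pmf (K y) z)"
    using split[of UNIV] sets.top[of ?M] by (simp add: nn_integral_multc)
  finally show ?thesis .
qed

primrec chain_marginal :: "('a \<Rightarrow> 'a pmf) \<Rightarrow> 'a \<Rightarrow> nat \<Rightarrow> 'a pmf" where
  "chain_marginal K x 0 = return_pmf x"
| "chain_marginal K x (Suc n) = bind_pmf (chain_marginal K x n) K"

lemma emeasure_chain_law_coordinate_eq:
  fixes K :: "'a :: countable \<Rightarrow> 'a pmf"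
  shows "emeasure (chain_law K x) {\<omega>. \<omega> n = z} = ennreal (pmf (chain_marginal K x n) z)"
proof (induction n arbitrary: z)
  case 0
  show ?case
    using emeasure_chain_law_path[of K x 0 "\<lambda>_. z"] by (auto simp: pmf_return indicator_def)
next
  case (Suc n)
  let ?M = "chain_law K x"
  have "{\<omega>. \<omega> (Suc n) = z} = (\<Union>y. {\<omega>. \<omega> n = y \<and> \<omega> (Suc n) = z})"
    by auto
  moreover have "{\<omega>. \<omega> n = y \<and> \<omega> (Suc n) = z} \<in> sets ?M" for y
    using sets.Int[OF sets_chain_law_Collect[of "\<lambda>a. a = y" n K x]
      sets_chain_law_Collect[of "\<lambda>a. a = z" "Suc n" K x]]
    by (simp add: Int_def)
  moreover have "disjoint_family (\<lambda>y. {\<omega>. \<omega> n = y \<and> \<omega> (Suc n) = z})"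
    by (auto simp: disjoint_family_on_def)
  ultimately have "emeasure ?M {\<omega>. \<omega> (Suc n) = z} =
      (\<integral>\<^sup>+y. emeasure ?M {\<omega>. \<omega> n = y \<and> \<omega> (Suc n) = z} \<partial>count_space UNIV)"
    using emeasure_UN_countable[where X = "\<lambda>y. {\<omega>. \<omega> n = y \<and> \<omega> (Suc n) = z}" and M = ?M and I = UNIV]
    by simp
  also have "\<dots> = (\<integral>\<^sup>+y. ennreal (pmf (K y) z) \<partial>chain_marginal K x n)"
    by (simp add: emeasure_chain_law_transition Suc.IH nn_integral_measure_pmf)
  finally show ?case
    by (simp add: ennreal_pmf_bind)
qed

lemma distr_chain_law_coordinate:
  fixes K :: "'a :: countable \<Rightarrow> 'a pmf"
  shows "distr (chain_law K x) (count_space UNIV) (\<lambda>\<omega>. \<omega> n) = measure_pmf (chain_marginal K x n)"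
  by (rule measure_eqI_countable[of _ UNIV])
     (simp_all add: emeasure_distr vimage_def emeasure_chain_law_coordinate_eq emeasure_pmf_single)

text \<open>Only countably many triples of a time and two states exist, so the forbidden transitions
  together form a null event. This is what makes absorbing states absorbing along
  trajectories.\<close>

lemma AE_chain_law_step:
  fixes K :: "'a :: countable \<Rightarrow> 'a pmf"
  shows "AE \<omega> in chain_law K x. \<forall>n. \<omega> (Suc n) \<in> set_pmf (K (\<omega> n))"
proof -
  have "AE \<omega> in chain_law K x. z \<notin> set_pmf (K y) \<longrightarrow> \<not> (\<omega> n = y \<and> \<omega> (Suc n) = z)" for n y z
  proof (cases "z \<in> set_pmf (K y)")
    case False
    then have "emeasure (chain_law K x) {\<omega>. \<omega> n = y \<and> \<omega> (Suc n) = z} = 0"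
      by (simp add: emeasure_chain_law_transition set_pmf_iff)
    moreover have "{\<omega>. \<omega> n = y \<and> \<omega> (Suc n) = z} \<in> sets (chain_law K x)"
      using sets.Int[OF sets_chain_law_Collect[of "\<lambda>a. a = y" n K x]
        sets_chain_law_Collect[of "\<lambda>a. a = z" "Suc n" K x]]
      by (simp add: Int_def)
    ultimately show ?thesis
      by (intro AE_I[of _ _ "{\<omega>. \<omega> n = y \<and> \<omega> (Suc n) = z}"]) auto
  qed simp
  then have "AE \<omega> in chain_law K x. \<forall>n y z. z \<notin> set_pmf (K y) \<longrightarrow> \<not> (\<omega> n = y \<and> \<omega> (Suc n) = z)"
    by (intro AE_all_countable[THEN iffD2] allI)
  then show ?thesis
    by eventually_elim blast
qed

text \<open>Iterating \<open>sub\<close> N times bounds w at x by the expected time outside A before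
  N plus the mean of w at time N. That mean is at most C times the probability of being outside A at
  time N, which tends to 0 whenever the series converges; a divergent series leaves nothing to
  prove.\<close>

lemma subsolution_le_suminf_marginal:
  fixes K :: "'a \<Rightarrow> 'a pmf" and w :: "'a \<Rightarrow> ennreal" and C :: ennreal
  assumes sub: "\<And>z. w z \<le> indicator (- A) z + (\<integral>\<^sup>+z'. w z' \<partial>K z)"
    and bound: "\<And>z. w z \<le> C * indicator (- A) z" and C: "C < \<top>"
  shows "w x \<le> (\<Sum>n. emeasure (chain_marginal K x n) (- A))"
proof (cases "(\<Sum>n. emeasure (chain_marginal K x n) (- A)) = \<top>")
  case False
  define p where "p n = emeasure (chain_marginal K x n) (- A)" for n
  have iterate: "w x \<le> (\<Sum>n<N. p n) + (\<integral>\<^sup>+z. w z \<partial>chain_marginal K x N)" for N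
  proof (induction N)
    case 0
    show ?case by simp
  next
    case (Suc N)
    have "(\<integral>\<^sup>+z. w z \<partial>chain_marginal K x N) \<le>
        (\<integral>\<^sup>+z. indicator (- A) z + (\<integral>\<^sup>+z'. w z' \<partial>K z) \<partial>chain_marginal K x N)"
      by (intro nn_integral_mono sub)
    also have "\<dots> = p N + (\<integral>\<^sup>+z. w z \<partial>chain_marginal K x (Suc N))"
      by (simp add: nn_integral_add p_def)
    finally show ?case
      using Suc.IH by (simp add: add.assoc) (meson add_left_mono order_trans)
  qed
  have le: "w x \<le> (\<Sum>n. p n) + C * p N" for N
  proof -
    have "(\<integral>\<^sup>+z. w z \<partial>chain_marginal K x N) \<le> (\<integral>\<^sup>+z. C * indicator (- A) z \<partial>chain_marginal K x N)"
      by (intro nn_integral_mono bound)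
    also have "\<dots> = C * p N"
      by (simp add: nn_integral_cmult_indicator p_def)
    finally show ?thesis
      using iterate[of N] sum_le_suminf[of p "{..<N}"]
      by (meson add_mono order_trans finite_lessThan summableI zero_le)
  qed
  have fin: "p n < \<top>" for n
    by (simp add: p_def less_top[symmetric])
  \<comment> \<open>The terms of a convergent series tend to 0; this is taken over the reals and
    carried back, all terms being finite.\<close>
  have "(\<lambda>n. enn2real (p n)) \<longlonglongrightarrow> 0"
  proof (rule summable_LIMSEQ_zero, rule summable_suminf_not_top)
    show "(\<Sum>n. ennreal (enn2real (p n))) \<noteq> \<top>"
      using False fin by (simp add: p_def)
  qed simp
  then have "(\<lambda>n. ennreal (enn2real (p n))) \<longlonglongrightarrow> ennreal 0"
    by (rule tendsto_ennrealI)
  then have "p \<longlonglongrightarrow> 0"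
    using fin by simp
  then have "(\<lambda>N. (\<Sum>n. p n) + C * p N) \<longlonglongrightarrow> (\<Sum>n. p n) + C * 0"
    using C by (intro tendsto_add tendsto_const ennreal_tendsto_cmult) auto
  then show ?thesis
    using le unfolding p_def[symmetric] by (auto intro: LIMSEQ_le_const)
qed simp

section \<open>The trapped walk\<close>

text \<open>The series is the mean number of times at which the walk is not absorbed. Almost surely
  no such time comes at or after absorption, so there are at most \<open>absorption_time\<close> of
  them.\<close>

lemma expected_absorption_time_ge_suminf:
  "(\<Sum>n. emeasure (chain_marginal (trap_kernel D) (Site x) n) (- {Site 0, Sink}))
    \<le> expected_absorption_time D x"
proof -
  let ?A = "{Site 0, Sink}"
  let ?M = "chain_law (trap_kernel D) (Site x)"
  have "emeasure (chain_marginal (trap_kernel D) (Site x) n) (- ?A) =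
      (\<integral>\<^sup>+\<omega>. indicator (- ?A) (\<omega> n) \<partial>?M)" for n
  proof -
    have "(\<integral>\<^sup>+\<omega>. indicator (- ?A) (\<omega> n) \<partial>?M) =
        (\<integral>\<^sup>+z. indicator (- ?A) z \<partial>distr ?M (count_space UNIV) (\<lambda>\<omega>. \<omega> n))"
      by (rule nn_integral_distr[symmetric]) auto
    then show ?thesis
      by (simp add: distr_chain_law_coordinate)
  qed
  then have "(\<Sum>n. emeasure (chain_marginal (trap_kernel D) (Site x) n) (- ?A)) =
      (\<Sum>n. \<integral>\<^sup>+\<omega>. indicator (- ?A) (\<omega> n) \<partial>?M)"
    by simp
  also have "\<dots> = (\<integral>\<^sup>+\<omega>. (\<Sum>n. indicator (- ?A) (\<omega> n)) \<partial>?M)"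
    by (rule nn_integral_suminf[symmetric]) measurable
  also have "\<dots> \<le> (\<integral>\<^sup>+\<omega>. ennreal_of_enat (absorption_time \<omega>) \<partial>?M)"
  proof (rule nn_integral_mono_AE)
    show "AE \<omega> in ?M. (\<Sum>n. indicator (- ?A) (\<omega> n)) \<le> ennreal_of_enat (absorption_time \<omega>)"
      using AE_chain_law_step[of "trap_kernel D" "Site x"]
    proof eventually_elim
      case (elim \<omega>)
      show ?case
      proof (cases "\<exists>n. \<omega> n \<in> ?A")
        case False
        then have "absorption_time \<omega> = \<infinity>"
          by (simp add: absorption_time_def top_enat_def)
        then show ?thesis by simp
      next
        case True
        then obtain n where "\<omega> n \<in> ?A" ..
        then have "absorption_time \<omega> \<in> enat ` {n. \<omega> n \<in> ?A}"
          unfolding absorption_time_def by (intro wellorder_InfI[of "enat n"]) simp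
        then obtain m where m: "absorption_time \<omega> = enat m" "\<omega> m \<in> ?A"
          by auto
        \<comment> \<open>Both absorbing states have a point mass as kernel, so a trajectory that
          follows the kernel cannot leave them.\<close>
        have "\<omega> (m + j) \<in> ?A" for j
        proof (induction j)
          case (Suc j)
          then show ?case
            using elim[rule_format, of "m + j"] by auto
        qed (use m(2) in simp)
        then have "\<omega> n \<in> ?A" if "n \<notin> {..<m}" for n
          using that by (metis le_Suc_ex lessThan_iff not_less)
        then have "(\<Sum>n. indicator (- ?A) (\<omega> n) :: ennreal) = (\<Sum>n<m. indicator (- ?A) (\<omega> n))"
          by (intro suminf_finite) auto
        also have "\<dots> \<le> (\<Sum>n<m. 1)"
          by (intro sum_mono) (simp add: indicator_def)
        finally show ?thesis
          by (simp add: m(1))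
      qed
    qed
  qed
  finally show ?thesis
    by (simp add: expected_absorption_time_def)
qed

text \<open>\<open>trap_slope D x\<close> is the increment of h from x to x + 1, so at a trap it
  already includes the kink there.\<close>

fun trap_harm trap_slope where
  "trap_harm D 0 = (0 :: nat)"
| "trap_harm D (Suc x) = trap_harm D x + trap_slope D x"
| "trap_slope D 0 = 1"
| "trap_slope D (Suc x) = trap_slope D x + (if Suc x \<in> D then trap_harm D x + trap_slope D x else 0)"

lemma trap_harm_harmonic:
  assumes "x \<ge> 1"
  shows "trap_harm D (x - 1) + trap_harm D (x + 1) = (if x \<in> D then 3 else 2) * trap_harm D x"
  using assms by (cases x) auto

lemma trap_harm_mono: "x \<le> z \<Longrightarrow> trap_harm D x \<le> trap_harm D z"
  by (rule lift_Suc_mono_le[of "trap_harm D"]) auto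

text \<open>The right end q is excluded because the slope may change at q itself.\<close>

lemma trap_harm_slope_gap:
  assumes "D \<inter> {p<..<q} = {}" "p + m < q"
  shows "trap_harm D (p + m) = trap_harm D p + m * trap_slope D p \<and> trap_slope D (p + m) = trap_slope D p"
  using assms(2)
proof (induction m)
  case (Suc m)
  moreover have "Suc (p + m) \<notin> D"
    using assms(1) Suc.prems by auto
  ultimately show ?case
    by auto
qed simp

text \<open>The value formula does reach q, since h(q) depends only on the value and slope at q -
  1.\<close>

lemma trap_harm_gap:
  assumes "D \<inter> {p<..<q} = {}" "p + m \<le> q"
  shows "trap_harm D (p + m) = trap_harm D p + m * trap_slope D p"
  using assms trap_harm_slope_gap[OF assms(1), of "m - 1"] by (cases m) auto

lemma trap_slope_pos: "trap_slope D x > 0"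
  by (induction x) auto

text \<open>The subsolution is the mean time spent strictly between p and q by the walk stopped on
  reaching q. Ignoring all other time only lowers the bound, and the function is explicit because no
  trap interferes inside the gap.\<close>

lemma expected_absorption_time_ge:
  assumes "1 \<le> p" "p < q" "D \<inter> {p<..<q} = {}"
  shows "ennreal (real (q - p) * (real (q - p) - 1) / real (trap_harm D q)) \<le> expected_absorption_time D 1"
proof -
  define L where "L = real (q - p)"
  define \<alpha> where "\<alpha> = L * (L - 1) / real (trap_harm D q)"
  \<comment> \<open>f solves the equation for the expected absorption time in the gap, \<open>\<alpha>\<close> makes it vanish
    at q; c has second difference 2 beyond p and is zero up to p + 1 by truncated subtraction.\<close>
  define c where "c x = real (x - p) * (real (x - p) - 1)" for x
  define f where "f x = \<alpha> * real (trap_harm D x) - c x" for x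
  define w where "w s = (case s of Sink \<Rightarrow> 0 | Site x \<Rightarrow> if x < q then f x else 0)" for s
  have L: "L \<ge> 1"
    using assms by (simp add: L_def)
  have hq: "trap_harm D q = trap_harm D p + (q - p) * trap_slope D p"
    using trap_harm_gap[OF assms(3), of "q - p"] assms(2) by simp
  then have "trap_harm D q > 0"
    using assms(2) trap_slope_pos[of D p] by simp
  then have hq_pos: "real (trap_harm D q) > 0"
    by simp
  have hq': "real (trap_harm D q) = real (trap_harm D p) + L * real (trap_slope D p)"
    by (simp only: hq L_def of_nat_add of_nat_mult)
  have \<alpha>: "\<alpha> \<ge> 0"
    using L hq_pos by (simp add: \<alpha>_def)
  have fq: "f q = 0"
    using hq_pos by (simp add: f_def \<alpha>_def c_def L_def)
  \<comment> \<open>Negative values would be lost in \<open>ennreal\<close>. As h is affine on the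
    gap and nonnegative at p, h(x) is at least the fraction m / L of h(q), which gives \<alpha> h(x)
    >= (L - 1) m >= c(x).\<close>
  have f_nonneg: "f x \<ge> 0" if "x \<le> q" for x
  proof (cases "x \<le> p")
    case True
    then show ?thesis
      using \<alpha> by (simp add: f_def c_def)
  next
    case False
    define m where "m = x - p"
    have m: "1 \<le> real m" "real m \<le> L"
      using False that by (auto simp: m_def L_def)
    have hx: "trap_harm D x = trap_harm D p + m * trap_slope D p"
      using trap_harm_gap[OF assms(3), of m] False that by (simp add: m_def)
    have "real m * real (trap_harm D q) \<le> L * real (trap_harm D x)"
      using mult_right_mono[OF m(2), of "real (trap_harm D p)"]
      by (simp add: hq' hx algebra_simps)
    then have "(L - 1) * (real m * real (trap_harm D q)) \<le> (L - 1) * (L * real (trap_harm D x))"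
      using L by (intro mult_left_mono) auto
    then have "(L - 1) * real m \<le> \<alpha> * real (trap_harm D x)"
      using hq_pos by (simp add: \<alpha>_def field_simps)
    moreover have "real m * (real m - 1) \<le> (L - 1) * real m"
      using mult_right_mono[of "real m - 1" "L - 1" "real m"] m by (simp add: mult.commute)
    ultimately show ?thesis
      by (simp add: f_def c_def m_def)
  qed
  \<comment> \<open>Since f vanishes at q, the cutoff in w agrees with f there, and the equation for
    f stays usable at q - 1.\<close>
  have w_f: "w (Site x) = f x" if "x \<le> q" for x
    using that fq by (auto simp: w_def)
  have w_nonneg: "w s \<ge> 0" for s
    using f_nonneg by (auto simp: w_def split: state.split)
  have c_diff: "c (x + 1) + c (x - 1) \<le> 2 * c x + 2" if "1 \<le> x" for x
  proof (cases "x \<le> p")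
    case False
    then have "real (x - p) = real x - real p" "real (x + 1 - p) = real x + 1 - real p"
      "real (x - 1 - p) = real x - 1 - real p"
      by auto
    then show ?thesis
      unfolding c_def by (simp add: algebra_simps)
  next
    case True
    then have "x + 1 - p = 0 \<or> x + 1 - p = 1" "x - 1 - p = 0" "x - p = 0"
      by auto
    then show ?thesis
      by (auto simp: c_def)
  qed
  have div_numeral: "ennreal a / numeral n = ennreal (a / numeral n)" if "a \<ge> 0" for a n
    using divide_ennreal[OF that, of "numeral n"] by simp
  have sub: "ennreal (w s) \<le> indicator (- {Site 0, Sink}) s + (\<integral>\<^sup>+z. ennreal (w z) \<partial>trap_kernel D s)" for s
  proof (cases s)
    case Sink
    then show ?thesis by (simp add: w_def)
  next
    case (Site x)
    show ?thesis
    proof (cases "1 \<le> x \<and> x < q")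
      case False
      then show ?thesis
        using Site assms by (auto simp: w_def f_def c_def)
    next
      case True
      then have vals: "w s = f x" "w (Site (x - 1)) = f (x - 1)" "w (Site (x + 1)) = f (x + 1)"
        "w Sink = 0"
        using w_f Site by (auto simp: w_def)
      have nn: "0 \<le> f (x - 1)" "0 \<le> f (x + 1)"
        using f_nonneg True by auto
      have harmonic: "\<alpha> * real (trap_harm D (x - 1)) + \<alpha> * real (trap_harm D (x + 1)) =
          (if x \<in> D then 3 else 2) * (\<alpha> * real (trap_harm D x))"
        using arg_cong[OF trap_harm_harmonic[of x D], of "\<lambda>n. \<alpha> * real n"] True
        by (auto simp: algebra_simps)
      show ?thesis
      proof (cases "x \<in> D")
        case x: True
        \<comment> \<open>A trap below q lies at or before p, where c is zero at the site and at
          both neighbours; there f is just a multiple of h.\<close>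
        then have "x \<le> p"
          using True assms(3) by (metis IntI emptyE greaterThanLessThan_iff not_less)
        then have "x + 1 - p = 0 \<or> x + 1 - p = 1" "x - 1 - p = 0" "x - p = 0"
          by auto
        then have "c (x + 1) = 0" "c (x - 1) = 0" "c x = 0"
          by (auto simp: c_def)
        then have "f x = (f (x - 1) + f (x + 1)) / 3"
          using harmonic x by (simp add: f_def)
        then have le: "f x \<le> 1 + (f (x - 1) + f (x + 1)) / 3"
          by linarith
        have "(\<integral>\<^sup>+z. ennreal (w z) \<partial>trap_kernel D s) = ennreal ((f (x - 1) + f (x + 1)) / 3)"
          using Site True x vals nn
          by (simp add: nn_integral_pmf_of_set ennreal_plus[symmetric] div_numeral del: ennreal_plus)
        then show ?thesis
          using le nn Site True vals
          by (simp add: ennreal_1[symmetric] ennreal_plus[symmetric] del: ennreal_1 ennreal_plus)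
      next
        case x: False
        have le: "f x \<le> 1 + (f (x - 1) + f (x + 1)) / 2"
        proof -
          have "\<alpha> * real (trap_harm D (x - 1)) + \<alpha> * real (trap_harm D (x + 1)) =
              2 * (\<alpha> * real (trap_harm D x))"
            using harmonic x by (simp only: if_False)
          moreover have "a - c0 \<le> 1 + (b - c1 + (d - c2)) / 2"
            if "b + d = 2 * a" "c2 + c1 \<le> 2 * c0 + 2" for a b d c0 c1 c2 :: real
            using that by (simp add: field_simps)
          ultimately show ?thesis
            unfolding f_def using c_diff[OF conjunct1[OF True]] by blast
        qed
        have "(\<integral>\<^sup>+z. ennreal (w z) \<partial>trap_kernel D s) = ennreal ((f (x - 1) + f (x + 1)) / 2)"
          using Site True x vals nn
          by (simp add: nn_integral_pmf_of_set ennreal_plus[symmetric] div_numeral del: ennreal_plus)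
        then show ?thesis
          using le nn Site True vals
          by (simp add: ennreal_1[symmetric] ennreal_plus[symmetric] del: ennreal_1 ennreal_plus)
      qed
    qed
  qed
  have bound: "ennreal (w s) \<le> ennreal (\<alpha> * real (trap_harm D q)) * indicator (- {Site 0, Sink}) s" for s
  proof (cases s)
    case Sink
    then show ?thesis by (simp add: w_def)
  next
    case (Site x)
    have "w s \<le> \<alpha> * real (trap_harm D q)"
    proof (cases "x < q")
      case True
      have "c x \<ge> 0"
        by (cases "x - p") (auto simp: c_def)
      then show ?thesis
        using mult_left_mono[OF _ \<alpha>, of "real (trap_harm D x)" "real (trap_harm D q)"] trap_harm_mono[of x q D] True
        by (simp add: Site w_def f_def)
    next
      case False
      then show ?thesis
        using \<alpha> by (simp add: Site w_def)
    qed
    moreover have "w (Site 0) = 0"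
      by (simp add: w_def f_def c_def)
    ultimately show ?thesis
      using Site by (auto simp: indicator_def intro!: ennreal_leI)
  qed
  \<comment> \<open>The starting site is at or before p, so c vanishes there and h(1) = 1 leaves
    exactly \<alpha>.\<close>
  have "1 - p = 0"
    using assms(1) by simp
  then have "w (Site 1) = \<alpha>"
    using assms w_f[of 1] by (simp add: f_def c_def)
  then have "ennreal \<alpha> \<le> (\<Sum>n. emeasure (chain_marginal (trap_kernel D) (Site 1) n) (- {Site 0, Sink}))"
    using subsolution_le_suminf_marginal[of "\<lambda>s. ennreal (w s)", OF sub bound, of "Site 1"] by simp
  also have "\<dots> \<le> expected_absorption_time D 1"
    by (rule expected_absorption_time_ge_suminf)
  finally show ?thesis
    by (simp add: \<alpha>_def L_def)
qed

section \<open>The greedy trap sequence\<close>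

text \<open>The state (p, v, s) consists of the k-th trap p and of the value v and slope s of
  \<^const>\<open>trap_harm\<close> there; \<open>p = 0\<close> for \<open>k = 0\<close> is not a trap.\<close>

fun greedy :: "(nat \<Rightarrow> nat) \<Rightarrow> nat \<Rightarrow> nat \<times> nat \<times> nat" where
  "greedy y 0 = (0, 0, 1)"
| "greedy y (Suc k) =
    (let (p, v, s) = greedy y k;
         q = (if p + 1 + k * (v + s) \<le> y (Suc k) then y (Suc k) else p + 1);
         v' = v + (q - p) * s
     in (q, v', s + v'))"

definition "greedy_trap y k = fst (greedy y k)"
definition "greedy_value y k = fst (snd (greedy y k))"
definition "greedy_slope y k = snd (snd (greedy y k))"

text \<open>The sum of value and slope is h at the site after the k-th trap, so the condition asks
  for a gap longer than k h(p + 1). For k = 0 it only asks that the first bound be positive.\<close>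

abbreviation "jump y k \<equiv> greedy_trap y k + 1 + k * (greedy_value y k + greedy_slope y k) \<le> y (Suc k)"

lemma greedy_trap_0: "greedy_trap y 0 = 0" and greedy_value_0: "greedy_value y 0 = 0" and greedy_slope_0: "greedy_slope y 0 = 1"
  by (simp_all add: greedy_trap_def greedy_value_def greedy_slope_def)

lemma greedy_trap_Suc: "greedy_trap y (Suc k) = (if jump y k then y (Suc k) else greedy_trap y k + 1)"
  and greedy_value_Suc: "greedy_value y (Suc k) = greedy_value y k + (greedy_trap y (Suc k) - greedy_trap y k) * greedy_slope y k"
  and greedy_slope_Suc: "greedy_slope y (Suc k) = greedy_slope y k + greedy_value y (Suc k)"
  by (simp_all add: greedy_trap_def greedy_value_def greedy_slope_def Let_def split: prod.splits)

lemma strict_mono_greedy_trap: "strict_mono (greedy_trap y)"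
  by (rule strict_mono_Suc_iff[THEN iffD2]) (auto simp: greedy_trap_Suc)

text \<open>A jump lands exactly on the bound; otherwise the trap advances by one while y advances
  by at least one.\<close>

lemma greedy_trap_le:
  assumes "strict_mono_on {1..} y" "\<And>k. k \<ge> 1 \<Longrightarrow> 0 < y k" "k \<ge> 1"
  shows "greedy_trap y k \<le> y k"
  using assms(3)
proof (induction k rule: dec_induct)
  case base
  then show ?case
    using assms(2)[of 1] by (auto simp: greedy_trap_Suc greedy_trap_0)
next
  case (step k)
  have "y k < y (Suc k)"
    using assms(1) step by (auto simp: strict_mono_on_def)
  then show ?case
    using step by (auto simp: greedy_trap_Suc)
qed

lemma trap_set_greedy_gap: "trap_set (greedy_trap y) \<inter> {greedy_trap y k<..<greedy_trap y (Suc k)} = {}"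
  using strict_mono_less[OF strict_mono_greedy_trap[of y]] by (auto simp: trap_set_def)

lemma trap_harm_greedy:
  "trap_harm (trap_set (greedy_trap y)) (greedy_trap y k) = greedy_value y k \<and> trap_slope (trap_set (greedy_trap y)) (greedy_trap y k) = greedy_slope y k"
proof (induction k)
  case 0
  show ?case
    by (simp add: greedy_trap_0 greedy_value_0 greedy_slope_0)
next
  case (Suc k)
  let ?D = "trap_set (greedy_trap y)"
  let ?p = "greedy_trap y k" and ?q = "greedy_trap y (Suc k)"
  have lt: "?p < ?q"
    using strict_mono_greedy_trap by (simp add: strict_mono_def)
  have h: "trap_harm ?D ?q = greedy_value y (Suc k)"
    using trap_harm_gap[OF trap_set_greedy_gap, of y k "?q - ?p"] lt Suc by (simp add: greedy_value_Suc)
  \<comment> \<open>The slope at q is the slope at the preceding site r, still inside the gap, plus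
    the kink h(q).\<close>
  obtain r where r: "?q = Suc r" "?p \<le> r"
    using lt by (cases ?q) auto
  have "trap_slope ?D r = greedy_slope y k"
    using trap_harm_slope_gap[OF trap_set_greedy_gap, of y k "r - ?p"] r Suc by simp
  moreover have "?q \<in> ?D"
    by (auto simp: trap_set_def)
  ultimately have "trap_slope ?D ?q = greedy_slope y (Suc k)"
    using h by (simp add: r(1) greedy_slope_Suc)
  then show ?case
    using h by simp
qed

text \<open>With L the gap length, h(q) = v + L s is at most L (v + s), and the jump condition gives
  L - 1 >= k (v + s); the quotient L (L - 1) / h(q) is therefore at least k. The assumption k >= 1
  puts p at a positive site.\<close>

lemma expected_absorption_time_jump:
  assumes "k \<ge> 1" "jump y k"
  shows "of_nat k \<le> expected_absorption_time (trap_set (greedy_trap y)) 1"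
proof -
  let ?D = "trap_set (greedy_trap y)"
  let ?p = "greedy_trap y k" and ?q = "greedy_trap y (Suc k)"
  define L v s where "L = real (?q - ?p)" and "v = real (greedy_value y k)" and "s = real (greedy_slope y k)"
  have lt: "?p < ?q"
    using strict_mono_greedy_trap by (simp add: strict_mono_def)
  have p: "1 \<le> ?p"
    using strict_monoD[OF strict_mono_greedy_trap, of 0 k y] assms(1) by simp
  have h: "real (trap_harm ?D ?q) = v + L * s"
    using trap_harm_greedy[of y "Suc k"] by (simp add: greedy_value_Suc L_def v_def s_def)
  have s: "s > 0" and v: "v \<ge> 0"
    using trap_harm_greedy[of y k] trap_slope_pos[of ?D ?p] by (simp_all add: s_def v_def)
  have L: "L \<ge> 1"
    using lt by (simp add: L_def)
  have "?p + 1 + k * (greedy_value y k + greedy_slope y k) \<le> ?q"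
    using assms(2) by (simp add: greedy_trap_Suc)
  then have "real (?p + 1 + k * (greedy_value y k + greedy_slope y k)) \<le> real ?q"
    by (simp only: of_nat_le_iff)
  then have "real k * (v + s) \<le> L - 1"
    using lt by (simp add: L_def v_def s_def of_nat_diff)
  then have "L * (real k * (v + s)) \<le> L * (L - 1)"
    using L by (intro mult_left_mono) auto
  moreover have "real k * (v + L * s) \<le> real k * (L * (v + s))"
    using mult_right_mono[OF L v] by (intro mult_left_mono) (auto simp: algebra_simps)
  ultimately have "real k * (v + L * s) \<le> L * (L - 1)"
    by (simp add: mult_ac)
  then have "real k \<le> L * (L - 1) / (v + L * s)"
    using s v L by (simp add: pos_le_divide_eq add_nonneg_pos)
  then have "ennreal (real k) \<le> ennreal (L * (L - 1) / (v + L * s))"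
    by (rule ennreal_leI)
  also have "\<dots> \<le> expected_absorption_time ?D 1"
    using expected_absorption_time_ge[OF p lt trap_set_greedy_gap] by (simp add: h L_def)
  finally show ?thesis
    by (simp add: ennreal_of_nat_eq_real_of_nat)
qed

text \<open>If jumps ceased from n on, value and slope would grow exactly at rate l, and each failed
  jump condition would bound y by a constant times k l^k, against the little-o assumption.\<close>

lemma jump_infinitely_often:
  assumes y: "(\<lambda>k. real k * ((3 + sqrt 5) / 2) ^ k) \<in> o(\<lambda>k. real (y k))"
  shows "\<exists>k\<ge>n. jump y k"
proof (rule ccontr)
  assume "\<not> ?thesis"
  then have no: "\<not> jump y k" if "k \<ge> n" for k
    using that by blast
  define l :: real where "l = (3 + sqrt 5) / 2"
  \<comment> \<open>The bound l >= 2 makes the weight l - 1 at least 1, so that \<phi> dominates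
    value plus slope.\<close>
  have "sqrt 5 \<ge> 2"
    by (rule real_le_rsqrt) simp
  then have l: "l \<ge> 2"
    by (simp add: l_def)
  have l2: "l * l = 3 * l - 1"
    by (simp add: l_def field_simps)
  \<comment> \<open>a left eigenvector for the eigenvalue l of the step without a jump\<close>
  define \<phi> where "\<phi> k = real (greedy_value y k) + (l - 1) * real (greedy_slope y k)" for k
  \<comment> \<open>A step without a jump sends (v, s) to (v + s, v + 2 s); the identity l * l = 3 *
    l - 1 turns the new coefficient of s into l (l - 1).\<close>
  have \<phi>_Suc: "\<phi> (Suc k) = l * \<phi> k" if "k \<ge> n" for k
  proof -
    have "\<phi> (Suc k) = l * real (greedy_value y k) + (2 * l - 1) * real (greedy_slope y k)"
      using no[OF that] unfolding \<phi>_def by (simp add: greedy_value_Suc greedy_slope_Suc greedy_trap_Suc algebra_simps)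
    also have "\<dots> = l * real (greedy_value y k) + (l * l - l) * real (greedy_slope y k)"
      by (simp add: l2)
    finally show ?thesis
      by (simp add: \<phi>_def algebra_simps)
  qed
  have \<phi>: "\<phi> (n + j) = l ^ j * \<phi> n" for j
    by (induction j) (simp_all add: \<phi>_Suc)
  have trap: "greedy_trap y (n + j) = greedy_trap y n + j" for j
  proof (induction j)
    case (Suc j)
    then show ?case
      using no[of "n + j"] greedy_trap_Suc[of y "n + j"] by (simp del: not_le)
  qed simp
  have \<phi>n: "\<phi> n \<ge> 0"
    using l by (simp add: \<phi>_def)
  \<comment> \<open>B collects what is frozen at time n: the trap position and \<phi>. The 2 pays
    for the linear growth of the later traps and keeps B positive.\<close>
  define B where "B = real (greedy_trap y n) + 2 + \<phi> n"
  have B: "B > 0"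
    using \<phi>n by (simp add: B_def)
  have less: "real (y (Suc k)) < B * (real (Suc k) * l ^ Suc k)" if k: "k \<ge> n" for k
  proof -
    obtain j where j: "k = n + j"
      using k by (metis le_Suc_ex)
    define P where "P = real (Suc k) * l ^ Suc k"
    have pow: "1 \<le> l ^ Suc k"
      using l by (intro one_le_power) simp
    have P: "real (Suc k) \<le> P"
      using mult_left_mono[OF pow, of "real (Suc k)"] by (simp add: P_def)
    have "real (greedy_value y k + greedy_slope y k) \<le> \<phi> k"
      using mult_right_mono[of 1 "l - 1" "real (greedy_slope y k)"] l by (simp add: \<phi>_def)
    also have "\<dots> = l ^ j * \<phi> n"
      using \<phi> j by simp
    also have "\<dots> \<le> l ^ Suc k * \<phi> n"
      using l j \<phi>n by (intro mult_right_mono power_increasing) auto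
    finally have "real k * real (greedy_value y k + greedy_slope y k) \<le> real (Suc k) * (l ^ Suc k * \<phi> n)"
      by (intro mult_mono) auto
    then have "real k * real (greedy_value y k + greedy_slope y k) \<le> P * \<phi> n"
      by (simp only: P_def mult.assoc)
    moreover have "real (y (Suc k)) < real (greedy_trap y k) + 1 + real k * real (greedy_value y k + greedy_slope y k)"
      using no[OF k] by (simp only: not_le) (metis of_nat_1 of_nat_add of_nat_less_iff of_nat_mult)
    moreover have "real (greedy_trap y k) + 1 \<le> (real (greedy_trap y n) + 2) * P"
    proof -
      have "real (greedy_trap y k) + 1 \<le> real (greedy_trap y n) * 1 + real (Suc k)"
        using trap[of j] j by simp
      also have "\<dots> \<le> real (greedy_trap y n) * P + P"
        using P by (intro add_mono mult_left_mono) auto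
      finally show ?thesis
        using P by (simp add: algebra_simps)
    qed
    ultimately have "real (y (Suc k)) < (real (greedy_trap y n) + 2) * P + P * \<phi> n"
      by linarith
    also have "\<dots> = B * P"
      by (simp add: B_def algebra_simps)
    finally show ?thesis
      by (simp only: P_def)
  qed
  \<comment> \<open>The constant 1 / B makes this the reverse of \<open>less\<close>; both are
    compared at one index beyond n and N, shifted by one because a jump at k concerns the bound at k
    + 1.\<close>
  have "eventually (\<lambda>k. real k * l ^ k \<le> 1 / B * real (y k)) sequentially"
    using landau_o.smallD[OF y, of "1 / B"] B l by (simp add: l_def[symmetric])
  then obtain N where N: "\<And>k. k \<ge> N \<Longrightarrow> real k * l ^ k \<le> 1 / B * real (y k)"
    by (auto simp: eventually_sequentially)
  have "B * (real (Suc (max n N)) * l ^ Suc (max n N)) \<le> real (y (Suc (max n N)))"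
    using N[of "Suc (max n N)"] B by (simp add: field_simps)
  with less[of "max n N"] show False
    by simp
qed

theorem theorem2p8:
  fixes y :: "nat \<Rightarrow> nat"
  assumes "\<And>k. k \<ge> 1 \<Longrightarrow> 0 < y k"
    and "strict_mono_on {1..} y"
    and "(\<lambda>k. real k * ((3 + sqrt 5) / 2) ^ k) \<in> o(\<lambda>k. real (y k))"
  shows "\<exists>x. trap_sequence x \<and> critical (trap_set x) \<and> (\<forall>k\<ge>1. x k \<le> y k)"
proof (intro exI conjI allI impI)
  show "trap_sequence (greedy_trap y)"
    using strict_mono_greedy_trap[of y] strict_monoD[OF strict_mono_greedy_trap, of 0 1 y]
    by (simp add: trap_sequence_def strict_mono_on_def strict_mono_def greedy_trap_0)
  have "of_nat n \<le> expected_absorption_time (trap_set (greedy_trap y)) 1" for n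
  proof -
    \<comment> \<open>Asking for \<open>Suc n\<close> rather than n ensures k >= 1, as the bound
      from a jump requires.\<close>
    obtain k where k: "k \<ge> Suc n" "jump y k"
      using jump_infinitely_often[OF assms(3)] by blast
    then have "(of_nat n :: ennreal) \<le> of_nat k"
      by (intro of_nat_mono) simp
    also have "\<dots> \<le> expected_absorption_time (trap_set (greedy_trap y)) 1"
      using k by (intro expected_absorption_time_jump) auto
    finally show ?thesis .
  qed
  then have "expected_absorption_time (trap_set (greedy_trap y)) 1 = \<top>"
    using ennreal_Ex_less_of_nat by (metis not_less top.not_eq_extremum)
  then show "critical (trap_set (greedy_trap y))"
    by (simp add: critical_def)
qed (use assms greedy_trap_le in auto)

end
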